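(* Let $N\ge 2$, $m>0$, and let $\mathbf b_0^*$ be the real optimizer of mass $m$ centered at lattice site $0$. The operator $\nabla^2H(\mathbf b_0^* )(j,k)$ has non-zero entries only when $j,k\in\{-2,-1,0,1,2\}$. The spectrum of $\tfrac{14}{11}mI+\nabla^2H(\mathbf b_0^* )$ is as follows: (1) There is one negative eigenvalue, given by $-\tfrac{28}{11}m$, with corresponding eigenvector $\mathbf b_0^*$. (2) There is a one-dimensional null-space spanned by $i\mathbf b_0^*$. (3) The remaining eigenvalues are positive and consist of: the eigenvalues $\tfrac{14}{11}m$ with eigenvectors $\mathbf e_j$, $i\mathbf e_j$ for $j\notin\{-2,-1,0,1,2\}$; the eigenvalues $m\times(\tfrac2{11},\tfrac2{11},\tfrac{26}{11},\tfrac{26}{11})$ with eigenvectors $\mathbf e_{-2},\mathbf e_2,i\mathbf e_{-2},i\mathbf e_2$ respectively; the eigenvalues $m\times(\tfrac{12}{11},\tfrac{40}{11})$ with eigenvectors $\mathbf e_1-\mathbf e_{-1}$, $i(\mathbf e_1-\mathbf e_{-1})$ respectively; and the eigenvalues $m\times(\tfrac{60}{11},8)$ with eigenvectors $\sqrt{\tfrac53}(\mathbf e_1+\mathbf e_{-1})-2\mathbf e_0$, $i\big(\sqrt{\tfrac53}(\mathbf e_1+\mathbf e_{-1})-2\mathbf e_0\big)$ respectively.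
   Context: Elements of $\mathbb C^{2N+1}$ are written $\mathbf b=(b_{-N},\dots,b_N)$, with $b_{-(N+1)}=b_{N+1}=0$, and $H(\mathbf b)=\sum_{j=-N}^N\big(\tfrac12|b_j|^4-2\,\mathrm{Re}(\bar b_j^2b_{j-1}^2)\big)$. $\mathbb C^{2N+1}$ is identified with the real vector space $\mathbb R^{4N+2}$ via $b_j=\alpha_j+i\beta_j$, with real inner product $\langle\mathbf u,\mathbf v\rangle=\mathrm{Re}\sum_ju_j\bar v_j$ (so $\mathbf u$ and $i\mathbf u$ are orthogonal). $\nabla^2H(\mathbf b)$ is the real Hessian of $H$ in the coordinates $(\alpha_j,\beta_j)$, regarded as a symmetric real-linear operator; $\nabla^2H(\mathbf b)(j,k)$ denotes its ($2\times2$ real) block coupling sites $j$ and $k$. $\mathbf e_j$ is the standard basis vector with entry $1$ at site $j$ and $0$ elsewhere. $\mathbf b_0^*$ is the vector with entries $\sqrt{3m/11}$ at sites $\pm1$, $\sqrt{5m/11}$ at site $0$, and $0$ elsewhere. *)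

theory Defs
  imports "HOL-Analysis.Analysis"
begin

text \<open>
  The space of vectors $(b_{-N},\dots,b_N)$ is \<open>complex ^ 'n\<close>, where the finite type \<open>'n\<close> is labelled
  by the lattice sites through a map \<open>s :: 'n \<Rightarrow> int\<close> which the theorem assumes to be a bijection onto
  $\{-N,\dots,N\}$. The library inner product on this type is
  $\langle u,v\rangle = \mathrm{Re}\sum_j u_j \bar v_j$, and the library \<open>Basis\<close> consists of the
  vectors with a single non-zero entry, equal to \<open>1\<close> or \<open>\<i>\<close>; its coordinates are therefore
  the real coordinates $\alpha_j = \mathrm{Re}\,b_j$ and $\beta_j = \mathrm{Im}\,b_j$.
\<close>

definition entry :: "('n::finite \<Rightarrow> int) \<Rightarrow> complex ^ 'n \<Rightarrow> int \<Rightarrow> complex" where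
  "entry s b j = (if j \<in> range s then b $ inv s j else 0)"

definition site_vec :: "('n::finite \<Rightarrow> int) \<Rightarrow> int \<Rightarrow> complex ^ 'n" where
  "site_vec s j = (\<chi> i. if s i = j then 1 else 0)"

definition hamiltonian :: "nat \<Rightarrow> ('n::finite \<Rightarrow> int) \<Rightarrow> complex ^ 'n \<Rightarrow> real" where
  "hamiltonian N s b =
     (\<Sum>j = - int N..int N.
        1 / 2 * cmod (entry s b j) ^ 4 - 2 * Re (cnj (entry s b j) ^ 2 * entry s b (j - 1) ^ 2))"

definition optimizer :: "('n::finite \<Rightarrow> int) \<Rightarrow> real \<Rightarrow> complex ^ 'n" where
  "optimizer s m =
     (\<chi> i. if s i = 0 then complex_of_real (sqrt (5 * m / 11))
          else if s i = 1 \<or> s i = - 1 then complex_of_real (sqrt (3 * m / 11))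
          else 0)"

definition partial_deriv :: "('a::euclidean_space \<Rightarrow> real) \<Rightarrow> 'a \<Rightarrow> 'a \<Rightarrow> real" where
  "partial_deriv f u x = deriv (\<lambda>t::real. f (x + t *\<^sub>R u)) 0"

definition second_partial :: "('a::euclidean_space \<Rightarrow> real) \<Rightarrow> 'a \<Rightarrow> 'a \<Rightarrow> 'a \<Rightarrow> real" where
  "second_partial f u v x = partial_deriv (\<lambda>y. partial_deriv f v y) u x"

text \<open>The matrix of second partial derivatives in the coordinates given by \<open>Basis\<close>, acting on \<open>w\<close>.\<close>

definition hessian :: "('a::euclidean_space \<Rightarrow> real) \<Rightarrow> 'a \<Rightarrow> 'a \<Rightarrow> 'a" where
  "hessian f x w = (\<Sum>u\<in>Basis. (\<Sum>v\<in>Basis. second_partial f u v x * (v \<bullet> w)) *\<^sub>R u)"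

text \<open>Index \<open>1\<close> of the block refers to the coordinate $\alpha$ of a site, index \<open>2\<close> to $\beta$.\<close>

definition coord_vec :: "('n::finite \<Rightarrow> int) \<Rightarrow> int \<Rightarrow> 2 \<Rightarrow> complex ^ 'n" where
  "coord_vec s j p = (if p = 1 then site_vec s j else \<i> *s site_vec s j)"

definition hessian_block ::
  "('n::finite \<Rightarrow> int) \<Rightarrow> (complex ^ 'n \<Rightarrow> real) \<Rightarrow> complex ^ 'n \<Rightarrow> int \<Rightarrow> int \<Rightarrow> real ^ 2 ^ 2" where
  "hessian_block s f b j k = (\<chi> p q. second_partial f (coord_vec s j p) (coord_vec s k q) b)"

definition is_eigenvector :: "('a::real_vector \<Rightarrow> 'a) \<Rightarrow> real \<Rightarrow> 'a \<Rightarrow> bool" where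
  "is_eigenvector L \<mu> u \<longleftrightarrow> u \<noteq> 0 \<and> L u = \<mu> *\<^sub>R u"

definition eigenspace :: "('a::real_vector \<Rightarrow> 'a) \<Rightarrow> real \<Rightarrow> 'a set" where
  "eigenspace L \<mu> = {u. L u = \<mu> *\<^sub>R u}"

definition eigenvalues :: "('a::real_vector \<Rightarrow> 'a) \<Rightarrow> real set" where
  "eigenvalues L = {\<mu>. \<exists>u. is_eigenvector L \<mu> u}"

end

theory Submission
  imports Defs
begin

text \<open>
  Differentiating the Hamiltonian twice gives, for a general base point $b$,
  \[ (\nabla^2 H(b) w)_j = 4|b_j|^2 w_j + 2 b_j^2 \bar w_j - 4 \bar w_j (b_{j-1}^2 + b_{j+1}^2)
       - 8 \bar b_j (b_{j-1} w_{j-1} + b_{j+1} w_{j+1}). \]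
  When $b$ is real, no term mixes real and imaginary parts, so the operator splits into two real
  nearest-neighbour operators. At the optimizer the coupling $-8 b_j b_{j\pm 1}$ vanishes
  except between site \<open>0\<close> and sites \<open>\<plusminus>1\<close>, where it equals $-\frac{24}{11} m \sqrt{5/3}$, and
  the diagonal is constant outside $\{-2,\dots,2\}$. Hence, in units of \<open>m / 11\<close>, the shifted
  Hessian acts on the real and on the imaginary parts through a symmetric $3\times 3$ block on
  the sites \<open>-1, 0, 1\<close> and is diagonal elsewhere (\<open>entry_shifted_hessian\<close>). Reflection symmetry
  splits the block into the antisymmetric vector \<open>(1, 0, -1)\<close> and a $2\times 2$ block, which is
  diagonalised by the optimizer itself and by \<open>w\<close>; all listed eigenvectors are thus checked
  by substitution.

  That the list is complete, with no further eigenvalues and no larger eigenspaces, follows from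
  linear algebra alone: eigenspaces for distinct eigenvalues are independent, so if
  eigenvectors span the whole space, then each eigenspace is spanned by those among them that
  belong to its eigenvalue (\<open>eigenspace_of_spanning_eigenpairs\<close>). It remains to see that
  the listed vectors span, which reduces to recovering the three unit vectors at \<open>-1, 0, 1\<close>
  from the three eigenvectors living there (\<open>span_trimer\<close>).
\<close>

section \<open>Operators whose eigenvectors span\<close>

text \<open>
  Apply \<open>L - \<nu>\<close> to a vanishing sum of eigenvectors: this kills the \<open>\<nu>\<close>-component and
  rescales the others by the non-zero factors \<open>\<mu> - \<nu>\<close>, so induction applies to a shorter sum.
\<close>

lemma eigenvectors_distinct_independent:
  fixes L :: "'a::real_vector \<Rightarrow> 'a"
  assumes L: "linear L" and "finite M"
    and "\<And>\<mu>. \<mu> \<in> M \<Longrightarrow> x \<mu> \<in> eigenspace L \<mu>"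
    and "(\<Sum>\<mu>\<in>M. x \<mu>) = 0"
  shows "\<forall>\<mu>\<in>M. x \<mu> = 0"
  using assms(2-)
proof (induction M arbitrary: x rule: finite_induct)
  case empty
  then show ?case by simp
next
  case (insert \<nu> M)
  have Lx: "L (x \<mu>) = \<mu> *\<^sub>R x \<mu>" if "\<mu> \<in> insert \<nu> M" for \<mu>
    using insert.prems(1)[OF that] by (simp add: eigenspace_def)
  have "(\<Sum>\<mu>\<in>M. (\<mu> - \<nu>) *\<^sub>R x \<mu>) = (\<Sum>\<mu>\<in>insert \<nu> M. (\<mu> - \<nu>) *\<^sub>R x \<mu>)"
    using insert.hyps by simp
  also have "\<dots> = (\<Sum>\<mu>\<in>insert \<nu> M. L (x \<mu>)) - \<nu> *\<^sub>R (\<Sum>\<mu>\<in>insert \<nu> M. x \<mu>)"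
    using Lx by (simp add: scaleR_left_diff_distrib sum_subtractf scaleR_sum_right)
  also have "\<dots> = 0"
    unfolding linear_sum[OF L, symmetric] insert.prems(2) by (simp add: linear_0[OF L])
  finally have "(\<Sum>\<mu>\<in>M. (\<mu> - \<nu>) *\<^sub>R x \<mu>) = 0" .
  moreover have "(\<mu> - \<nu>) *\<^sub>R x \<mu> \<in> eigenspace L \<mu>" if "\<mu> \<in> M" for \<mu>
    using Lx that by (simp add: eigenspace_def linear_scale[OF L])
  ultimately have "\<forall>\<mu>\<in>M. (\<mu> - \<nu>) *\<^sub>R x \<mu> = 0"
    by (intro insert.IH) auto
  then have "\<forall>\<mu>\<in>M. x \<mu> = 0"
    using insert.hyps by auto
  with insert show ?case
    by simp
qed

lemma subspace_eigenspace: "linear L \<Longrightarrow> subspace (eigenspace L \<mu>)"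
  by (auto simp: eigenspace_def subspace_def linear_0 linear_add linear_scale algebra_simps)

text \<open>
  Write an eigenvector \<open>u\<close> for \<open>\<nu>\<close> as a combination of the given ones and group the terms by
  eigenvalue; subtracting \<open>u\<close> from the \<open>\<nu>\<close>-group leaves a vanishing sum of eigenvectors for
  distinct eigenvalues, so \<open>u\<close> equals its \<open>\<nu>\<close>-group. If \<open>\<nu>\<close> is
  no eigenvalue, both sides are \<open>{0}\<close>.
\<close>

lemma eigenspace_of_spanning_eigenpairs:
  fixes L :: "'a::real_vector \<Rightarrow> 'a"
  assumes L: "linear L" and P: "finite P"
    and eig: "\<And>\<mu> v. (\<mu>, v) \<in> P \<Longrightarrow> L v = \<mu> *\<^sub>R v"
    and span: "span (snd ` P) = UNIV"
  shows "eigenspace L \<nu> = span {v. (\<nu>, v) \<in> P}"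
proof
  show "span {v. (\<nu>, v) \<in> P} \<subseteq> eigenspace L \<nu>"
    using eig by (intro span_minimal subspace_eigenspace L) (auto simp: eigenspace_def)
next
  define S where "S \<mu> = span {v. (\<mu>, v) \<in> P}" for \<mu>
  have S_eig: "S \<mu> \<subseteq> eigenspace L \<mu>" for \<mu>
    unfolding S_def using eig
    by (intro span_minimal subspace_eigenspace L) (auto simp: eigenspace_def)
  show "eigenspace L \<nu> \<subseteq> span {v. (\<nu>, v) \<in> P}"
  proof
    fix u assume u: "u \<in> eigenspace L \<nu>"
    define M where "M = insert \<nu> (fst ` P)"
    have M: "finite M" "\<nu> \<in> M"
      using P by (auto simp: M_def)
    have "u \<in> span (snd ` P)"
      using span by simp
    then obtain c where c: "u = (\<Sum>v\<in>snd ` P. c v *\<^sub>R v)"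
      unfolding span_finite[OF finite_imageI[OF P]] by (rule imageE)
    have "\<forall>v\<in>snd ` P. \<exists>\<mu>. (\<mu>, v) \<in> P"
      by force
    then obtain g where g: "\<forall>v\<in>snd ` P. (g v, v) \<in> P"
      by (rule bchoice[THEN exE])
    \<comment> \<open>A vector occurring in \<open>P\<close> with several eigenvalues (necessarily \<open>0\<close>) is counted once, under \<open>g v\<close>.\<close>
    define y where "y \<mu> = (\<Sum>v\<in>{v \<in> snd ` P. g v = \<mu>}. c v *\<^sub>R v)" for \<mu>
    have y: "y \<mu> \<in> S \<mu>" for \<mu>
      unfolding y_def S_def using g by (intro span_sum span_scale span_base) auto
    have u_sum: "u = (\<Sum>\<mu>\<in>M. y \<mu>)"
      unfolding y_def c
    proof (rule sum.group[symmetric])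
      show "g ` snd ` P \<subseteq> M"
        using g by (force simp: M_def)
    qed (use P M in auto)
    \<comment> \<open>The vanishing sum to which independence is applied.\<close>
    define x where "x \<mu> = (if \<mu> = \<nu> then y \<mu> - u else y \<mu>)" for \<mu>
    have "x \<mu> \<in> eigenspace L \<mu>" for \<mu>
      using y[of \<mu>] S_eig[of \<mu>] u subspace_diff[OF subspace_eigenspace[OF L]]
      by (auto simp: x_def)
    moreover have "(\<Sum>\<mu>\<in>M. x \<mu>) = (\<Sum>\<mu>\<in>M. y \<mu>) - u"
      unfolding x_def using M by (simp add: sum.remove)
    ultimately have "\<forall>\<mu>\<in>M. x \<mu> = 0"
      using u_sum by (intro eigenvectors_distinct_independent[OF L M(1)]) auto
    then have "u = y \<nu>"
      using M by (auto simp: x_def)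
    then show "u \<in> span {v. (\<nu>, v) \<in> P}"
      using y by (simp add: S_def)
  qed
qed

lemma eigenvalues_of_spanning_eigenpairs:
  fixes L :: "'a::real_vector \<Rightarrow> 'a"
  assumes "linear L" and "finite P"
    and eig: "\<And>\<mu> v. (\<mu>, v) \<in> P \<Longrightarrow> is_eigenvector L \<mu> v"
    and "span (snd ` P) = UNIV"
  shows "eigenvalues L = fst ` P"
proof (intro set_eqI iffI)
  fix \<mu> assume "\<mu> \<in> eigenvalues L"
  then obtain u where "u \<noteq> 0" "u \<in> eigenspace L \<mu>"
    by (auto simp: eigenvalues_def is_eigenvector_def eigenspace_def)
  then have "u \<noteq> 0" "u \<in> span {v. (\<mu>, v) \<in> P}"
    using eigenspace_of_spanning_eigenpairs[of L P \<mu>] assms by (auto simp: is_eigenvector_def)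
  then have "{v. (\<mu>, v) \<in> P} \<noteq> {}"
    by (metis span_empty singletonD)
  then show "\<mu> \<in> fst ` P"
    by force
qed (use eig in \<open>fastforce simp: eigenvalues_def\<close>)

section \<open>The Hessian of the Hamiltonian\<close>

text \<open>
  The Hessian is defined through coordinates; a representation of the mixed second derivatives
  by one linear map, valid for all directions, removes the reference to the basis.
\<close>

lemma hessian_eqI:
  fixes A :: "'a::euclidean_space \<Rightarrow> 'a"
  assumes A: "linear A" and sp: "\<And>u v. second_partial f u v x = u \<bullet> A v"
  shows "hessian f x = A"
proof
  fix w
  have "(\<Sum>v\<in>Basis. second_partial f u v x * (v \<bullet> w)) = u \<bullet> A w" for u
  proof -
    have "(\<Sum>v\<in>Basis. second_partial f u v x * (v \<bullet> w)) = u \<bullet> (\<Sum>v\<in>Basis. A ((w \<bullet> v) *\<^sub>R v))"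
      by (simp add: sp inner_sum_right linear_scale[OF A] inner_commute mult.commute)
    also have "(\<Sum>v\<in>Basis. A ((w \<bullet> v) *\<^sub>R v)) = A w"
      by (simp add: linear_sum[OF A, symmetric] euclidean_representation)
    finally show ?thesis .
  qed
  then have "hessian f x w = (\<Sum>u\<in>Basis. (A w \<bullet> u) *\<^sub>R u)"
    by (simp add: hessian_def inner_commute)
  then show "hessian f x w = A w"
    by (simp add: euclidean_representation)
qed

text \<open>
  The Hamiltonian is a sum of such terms over neighbouring sites, with \<open>z\<close> the value at the upper
  site and \<open>y\<close> the value at the lower one, so all calculus happens in two complex variables.
\<close>

definition bond :: "complex \<Rightarrow> complex \<Rightarrow> real" where
  "bond z y = 1 / 2 * cmod z ^ 4 - 2 * Re (cnj z ^ 2 * y ^ 2)"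

definition bond_deriv :: "complex \<Rightarrow> complex \<Rightarrow> complex \<Rightarrow> complex \<Rightarrow> real" where
  "bond_deriv z y \<zeta> \<eta> = \<zeta> \<bullet> (2 * z * cnj z * z - 4 * cnj z * y\<^sup>2) - \<eta> \<bullet> (4 * cnj y * z\<^sup>2)"

lemma bond_has_derivative:
  "((\<lambda>t. bond (z + t *\<^sub>R \<zeta>) (y + t *\<^sub>R \<eta>)) has_real_derivative bond_deriv z y \<zeta> \<eta>) (at 0)"
proof -
  have c: "cmod x ^ 4 = ((Re x)\<^sup>2 + (Im x)\<^sup>2)\<^sup>2" for x
    by (simp flip: cmod_power2)
  show ?thesis
    unfolding bond_def c bond_deriv_def
    by (auto intro!: derivative_eq_intros simp: power2_eq_square inner_complex_def) (simp add: algebra_simps)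
qed

text \<open>
  The two components, at \<open>y\<close> and at \<open>z\<close>, of the Hessian of \<open>bond\<close> at \<open>(z, y)\<close> applied to
  \<open>(\<zeta>, \<eta>)\<close>. They are separated so that the sum over bonds can be rearranged into a sum over sites.
\<close>

definition bond_hess_snd :: "complex \<Rightarrow> complex \<Rightarrow> complex \<Rightarrow> complex \<Rightarrow> complex" where
  "bond_hess_snd z y \<zeta> \<eta> = - 4 * (cnj \<eta> * z\<^sup>2 + 2 * cnj y * z * \<zeta>)"

definition bond_hess_fst :: "complex \<Rightarrow> complex \<Rightarrow> complex \<Rightarrow> complex \<Rightarrow> complex" where
  "bond_hess_fst z y \<zeta> \<eta> = 4 * z * cnj z * \<zeta> + 2 * z\<^sup>2 * cnj \<zeta> - 4 * (cnj \<zeta> * y\<^sup>2 + 2 * cnj z * y * \<eta>)"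

lemma bond_deriv_has_derivative:
  "((\<lambda>t. bond_deriv (z + t *\<^sub>R \<zeta>') (y + t *\<^sub>R \<eta>') \<zeta> \<eta>) has_real_derivative
     (\<zeta>' \<bullet> bond_hess_fst z y \<zeta> \<eta> + \<eta>' \<bullet> bond_hess_snd z y \<zeta> \<eta>)) (at 0)"
  unfolding bond_deriv_def bond_hess_fst_def bond_hess_snd_def
  by (auto intro!: derivative_eq_intros simp: power2_eq_square inner_complex_def) (simp add: algebra_simps)

lemma entry_site [simp]: "inj s \<Longrightarrow> entry s b (s i) = b $ i"
  by (simp add: entry_def)

lemma entry_add [simp]: "entry s (u + v) j = entry s u j + entry s v j"
  by (simp add: entry_def)

lemma entry_diff [simp]: "entry s (u - v) j = entry s u j - entry s v j"
  by (simp add: entry_def)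

lemma entry_scaleR [simp]: "entry s (c *\<^sub>R u) j = c *\<^sub>R entry s u j"
  by (simp add: entry_def)

lemma entry_smult [simp]: "entry s (c *s u) j = c * entry s u j"
  by (simp add: entry_def)

lemma partial_deriv_hamiltonian:
  "partial_deriv (hamiltonian N s) v x =
    (\<Sum>j = - int N..int N.
       bond_deriv (entry s x j) (entry s x (j - 1)) (entry s v j) (entry s v (j - 1)))"
  unfolding partial_deriv_def hamiltonian_def bond_def[symmetric]
  by (rule DERIV_imp_deriv) (auto intro!: DERIV_sum bond_has_derivative)

text \<open>
  Site \<open>j\<close> is the upper end of the bond \<open>(j, j - 1)\<close> and the lower end of \<open>(j + 1, j)\<close>; each
  bond contributes the corresponding component of its Hessian.
\<close>

definition hess_at :: "('n::finite \<Rightarrow> int) \<Rightarrow> complex ^ 'n \<Rightarrow> complex ^ 'n \<Rightarrow> complex ^ 'n" where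
  "hess_at s b w = (\<chi> i.
     bond_hess_fst (entry s b (s i)) (entry s b (s i - 1)) (entry s w (s i)) (entry s w (s i - 1)) +
     bond_hess_snd (entry s b (s i + 1)) (entry s b (s i)) (entry s w (s i + 1)) (entry s w (s i)))"

lemma inner_entries:
  assumes "bij_betw s UNIV {- int N..int N}"
  shows "u \<bullet> v = (\<Sum>j = - int N..int N. entry s u j \<bullet> entry s v j)"
proof -
  have "inj s" using assms by (simp add: bij_betw_def)
  have "(\<Sum>j = - int N..int N. entry s u j \<bullet> entry s v j) = (\<Sum>i\<in>UNIV. entry s u (s i) \<bullet> entry s v (s i))"
    using sum.reindex_bij_betw[OF assms, of "\<lambda>j. entry s u j \<bullet> entry s v j"] by simp
  also have "\<dots> = u \<bullet> v" using \<open>inj s\<close> by (simp add: inner_vec_def)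
  finally show ?thesis by simp
qed

lemma entry_outside: "j \<notin> range s \<Longrightarrow> entry s u j = 0"
  by (simp add: entry_def)

text \<open>
  Summation by parts on the lattice: the terms carrying \<open>u\<close> at the lower end of a bond are shifted by
  one site. The two boundary terms vanish because \<open>u\<close>, respectively \<open>b\<close>, is zero outside the
  lattice.
\<close>

lemma second_partial_hamiltonian:
  assumes bij: "bij_betw s UNIV {- int N..int N}"
  shows "second_partial (hamiltonian N s) u v b = u \<bullet> hess_at s b v"
proof -
  have inj: "inj s" and range: "range s = {- int N..int N}"
    using bij by (auto simp: bij_betw_def)
  let ?b = "entry s b" and ?u = "entry s u" and ?v = "entry s v"
  define p where "p j = bond_hess_fst (?b j) (?b (j - 1)) (?v j) (?v (j - 1))" for j
  define q where "q j = bond_hess_snd (?b j) (?b (j - 1)) (?v j) (?v (j - 1))" for j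
  have "second_partial (hamiltonian N s) u v b =
      (\<Sum>j = - int N..int N. ?u j \<bullet> p j + ?u (j - 1) \<bullet> q j)"
    unfolding second_partial_def partial_deriv_hamiltonian
    unfolding partial_deriv_def p_def q_def
    by (rule DERIV_imp_deriv) (auto intro!: DERIV_sum bond_deriv_has_derivative)
  also have "\<dots> = (\<Sum>j = - int N..int N. ?u j \<bullet> p j) + (\<Sum>j = - int N..int N. ?u (j - 1) \<bullet> q j)"
    by (rule sum.distrib)
  also have "(\<Sum>j = - int N..int N. ?u (j - 1) \<bullet> q j) = (\<Sum>j = - int N - 1..int N - 1. ?u j \<bullet> q (j + 1))"
    by (rule sum.reindex_bij_witness[of _ "\<lambda>j. j + 1" "\<lambda>j. j - 1"]) auto
  also have "\<dots> = (\<Sum>j = - int N - 1..int N. ?u j \<bullet> q (j + 1))"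
    using range by (intro sum.mono_neutral_left) (auto simp: q_def bond_hess_snd_def entry_outside)
  also have "\<dots> = (\<Sum>j = - int N..int N. ?u j \<bullet> q (j + 1))"
    using range by (intro sum.mono_neutral_right) (auto simp: entry_outside)
  also have "(\<Sum>j = - int N..int N. ?u j \<bullet> p j) + \<dots> = (\<Sum>j = - int N..int N. ?u j \<bullet> entry s (hess_at s b v) j)"
    unfolding sum.distrib[symmetric]
  proof (rule sum.cong)
    fix j assume "j \<in> {- int N..int N}"
    then obtain i where "j = s i" using range by blast
    then show "?u j \<bullet> p j + ?u j \<bullet> q (j + 1) = ?u j \<bullet> entry s (hess_at s b v) j"
      using inj by (simp add: hess_at_def p_def q_def inner_add_right)
  qed simp
  finally show ?thesis by (simp add: inner_entries[OF bij])
qed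

lemma linear_hess_at: "linear (hess_at s b)"
  by (rule linearI)
     (simp_all add: hess_at_def vec_eq_iff bond_hess_fst_def bond_hess_snd_def
       scaleR_conv_of_real[where 'a = complex] algebra_simps)

lemma hessian_hamiltonian:
  assumes "bij_betw s UNIV {- int N..int N}"
  shows "hessian (hamiltonian N s) b = hess_at s b"
  by (intro hessian_eqI linear_hess_at second_partial_hamiltonian assms)

section \<open>The shifted Hessian at the optimizer\<close>

lemma vec_eq_entries:
  assumes "inj s"
  shows "u = v \<longleftrightarrow> (\<forall>j\<in>range s. entry s u j = entry s v j)"
  using assms by (simp add: vec_eq_iff)

lemma entry_site_vec:
  assumes "inj s"
  shows "entry s (site_vec s k) j = (if j = k \<and> k \<in> range s then 1 else 0)"
  using assms by (auto simp: entry_def site_vec_def f_inv_into_f)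

text \<open>
  The optimizer as a real function on all of the integers, so that neighbours of boundary sites need no
  special treatment.
\<close>

definition profile :: "real \<Rightarrow> int \<Rightarrow> real" where
  "profile m j = (if j = 0 then sqrt (5 * m / 11) else if \<bar>j\<bar> = 1 then sqrt (3 * m / 11) else 0)"

lemma entry_optimizer:
  assumes "inj s" "{- 1, 0, 1} \<subseteq> range s"
  shows "entry s (optimizer s m) j = complex_of_real (profile m j)"
proof (cases "j \<in> range s")
  case True
  then obtain i where "j = s i" by blast
  then show ?thesis using assms(1) by (auto simp: optimizer_def profile_def)
next
  case False
  then have "j \<noteq> 0" "\<bar>j\<bar> \<noteq> 1" using assms(2) by (auto simp: abs_if)
  then show ?thesis using False by (simp add: entry_def profile_def)
qed

lemma profile_products:
  assumes "m > 0"
  shows "profile m j * profile m j = (if j = 0 then 5 * m / 11 else if \<bar>j\<bar> = 1 then 3 * m / 11 else 0)"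
    and "profile m 0 * profile m 1 = 3 * m / 11 * sqrt (5 / 3)"
    and "profile m 0 * profile m (- 1) = 3 * m / 11 * sqrt (5 / 3)"
proof -
  have "sqrt (5 * m / 11) * sqrt (3 * m / 11) = sqrt ((3 * m / 11)\<^sup>2 * (5 / 3))"
    by (simp add: power2_eq_square flip: real_sqrt_mult)
  also have "\<dots> = 3 * m / 11 * sqrt (5 / 3)"
    using assms unfolding real_sqrt_mult real_sqrt_abs by simp
  finally show "profile m 0 * profile m 1 = 3 * m / 11 * sqrt (5 / 3)"
    "profile m 0 * profile m (- 1) = 3 * m / 11 * sqrt (5 / 3)"
    by (simp_all add: profile_def)
qed (use assms in \<open>simp add: profile_def\<close>)

text \<open>
  The nearest-neighbour operator that remains at the optimizer, in units of \<open>m / 11\<close>. The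
  coefficients \<open>c0, c1, c2\<close> are the diagonal entries at the sites \<open>0\<close>, \<open>\<plusminus>1\<close>, \<open>\<plusminus>2\<close>; they differ
  between real and imaginary parts, while the coupling and the far diagonal entry \<open>14\<close> do not.
\<close>

definition trimer_op :: "real \<Rightarrow> real \<Rightarrow> real \<Rightarrow> (int \<Rightarrow> real) \<Rightarrow> int \<Rightarrow> real" where
  "trimer_op c0 c1 c2 x j =
     (if j = 0 then c0 * x 0 - 24 * sqrt (5 / 3) * (x 1 + x (- 1))
      else if \<bar>j\<bar> = 1 then c1 * x j - 24 * sqrt (5 / 3) * x 0
      else if \<bar>j\<bar> = 2 then c2 * x j
      else 14 * x j)"

definition shifted_hessian :: "('n::finite \<Rightarrow> int) \<Rightarrow> real \<Rightarrow> complex ^ 'n \<Rightarrow> complex ^ 'n" where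
  "shifted_hessian s m u = (14 / 11 * m) *\<^sub>R u + hess_at s (optimizer s m) u"

lemma linear_shifted_hessian: "linear (shifted_hessian s m)"
  unfolding shifted_hessian_def
  by (intro linear_compose_add linear_compose_scale_right linear_hess_at linear_ident)

text \<open>
  At a real base point conjugation only changes the sign of some terms in the imaginary part, so the
  two parts decouple; only the diagonal coefficients see the difference.
\<close>

lemma entry_hess_at_real:
  fixes a :: "int \<Rightarrow> real"
  assumes "inj s" "j \<in> range s" "\<And>j. entry s b j = complex_of_real (a j)"
  defines "nn \<equiv> a (j - 1) * a (j - 1) + a (j + 1) * a (j + 1)"
  shows "Re (entry s (hess_at s b w) j) = (6 * (a j * a j) - 4 * nn) * Re (entry s w j)
      - 8 * (a j * a (j - 1) * Re (entry s w (j - 1)) + a j * a (j + 1) * Re (entry s w (j + 1)))"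
    and "Im (entry s (hess_at s b w) j) = (2 * (a j * a j) + 4 * nn) * Im (entry s w j)
      - 8 * (a j * a (j - 1) * Im (entry s w (j - 1)) + a j * a (j + 1) * Im (entry s w (j + 1)))"
proof -
  obtain i where "j = s i" using assms(2) by blast
  then show "Re (entry s (hess_at s b w) j) = (6 * (a j * a j) - 4 * nn) * Re (entry s w j)
      - 8 * (a j * a (j - 1) * Re (entry s w (j - 1)) + a j * a (j + 1) * Re (entry s w (j + 1)))"
    "Im (entry s (hess_at s b w) j) = (2 * (a j * a j) + 4 * nn) * Im (entry s w j)
      - 8 * (a j * a (j - 1) * Im (entry s w (j - 1)) + a j * a (j + 1) * Im (entry s w (j + 1)))"
    using assms(1,3)
    by (simp_all add: hess_at_def bond_hess_fst_def bond_hess_snd_def nn_def power2_eq_square algebra_simps)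
qed

text \<open>
  The diagonal entries come from $b_0^2 = 5m/11$ and $b_{\pm 1}^2 = 3m/11$. For the real part they
  are $14 + 6\cdot 5 - 4\cdot(3+3) = 20$ at site \<open>0\<close>, $14 + 6\cdot 3 - 4\cdot 5 = 12$ at
  \<open>\<plusminus>1\<close> and $14 - 4\cdot 3 = 2$ at \<open>\<plusminus>2\<close>; for the imaginary part
  $14 + 2\cdot 5 + 4\cdot(3+3) = 48$, $14 + 2\cdot 3 + 4\cdot 5 = 40$ and
  $14 + 4\cdot 3 = 26$.
\<close>

lemma entry_shifted_hessian:
  assumes inj: "inj s" and j: "j \<in> range s" and sub: "{- 1, 0, 1} \<subseteq> range s" and m: "m > 0"
  shows "Re (entry s (shifted_hessian s m u) j) = m / 11 * trimer_op 20 12 2 (\<lambda>j. Re (entry s u j)) j"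
    and "Im (entry s (shifted_hessian s m u) j) = m / 11 * trimer_op 48 40 26 (\<lambda>j. Im (entry s u j)) j"
proof -
  note e = entry_hess_at_real[OF inj _ entry_optimizer[OF inj sub]]
  have far: "profile m j * x = 0" if "\<bar>j\<bar> \<ge> 2" for j x
    using that by (auto simp: profile_def)
  consider "j = 0" | "j = 1" | "j = - 1" | "j = 2" | "j = - 2" | "\<bar>j\<bar> \<ge> 3"
    by linarith
  then have "Re (entry s (shifted_hessian s m u) j) = m / 11 * trimer_op 20 12 2 (\<lambda>j. Re (entry s u j)) j \<and>
    Im (entry s (shifted_hessian s m u) j) = m / 11 * trimer_op 48 40 26 (\<lambda>j. Im (entry s u j)) j"
  proof cases
    case 1
    then show ?thesis
      using j by (simp add: shifted_hessian_def e profile_products[OF m] trimer_op_def) (simp add: algebra_simps)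
  next
    case 2
    then show ?thesis
      using j by (simp add: shifted_hessian_def e far profile_products[OF m] mult.commute[of "profile m 1"] trimer_op_def) (simp add: algebra_simps)
  next
    case 3
    then show ?thesis
      using j by (simp add: shifted_hessian_def e far profile_products[OF m] mult.commute[of "profile m (- 1)"] trimer_op_def) (simp add: algebra_simps)
  qed (use j in \<open>auto simp: shifted_hessian_def e far profile_products[OF m] trimer_op_def algebra_simps\<close>)
  then show "Re (entry s (shifted_hessian s m u) j) = m / 11 * trimer_op 20 12 2 (\<lambda>j. Re (entry s u j)) j"
    "Im (entry s (shifted_hessian s m u) j) = m / 11 * trimer_op 48 40 26 (\<lambda>j. Im (entry s u j)) j"
    by auto
qed

lemma trimer_eigenI:
  assumes "inj s" "{- 1, 0, 1} \<subseteq> range s" "m > 0"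
    and "\<And>j. trimer_op 20 12 2 (\<lambda>j. Re (entry s u j)) j = c * Re (entry s u j)"
    and "\<And>j. trimer_op 48 40 26 (\<lambda>j. Im (entry s u j)) j = c * Im (entry s u j)"
  shows "shifted_hessian s m u = (c / 11 * m) *\<^sub>R u"
  unfolding vec_eq_entries[OF assms(1)] complex_eq_iff
  using assms by (simp add: entry_shifted_hessian)

text \<open>
  The first two vectors are combinations of \<open>p + r\<close> and \<open>q\<close> with determinant \<open>-(2 * \<alpha> + \<beta> * \<rho>)\<close>,
  hence give back both; together with \<open>p - r\<close> they give \<open>p\<close> and \<open>r\<close>. This is used for the
  optimizer, \<open>w\<close> and the antisymmetric vector, and again for their multiples by \<open>\<i>\<close>.
\<close>

lemma span_trimer:
  fixes p q r :: "'a::real_vector"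
  assumes 1: "\<alpha> *\<^sub>R (p + r) + \<beta> *\<^sub>R q \<in> span X" and 2: "\<rho> *\<^sub>R (p + r) - 2 *\<^sub>R q \<in> span X"
    and 3: "p - r \<in> span X" and nz: "2 * \<alpha> + \<beta> * \<rho> \<noteq> 0"
  shows "{p, q, r} \<subseteq> span X"
proof -
  have cancel: "v \<in> span X" if "c *\<^sub>R v \<in> span X" "c \<noteq> 0" for c v
    using span_scale[OF that(1), of "inverse c"] that(2) by simp
  have "2 *\<^sub>R (\<alpha> *\<^sub>R (p + r) + \<beta> *\<^sub>R q) + \<beta> *\<^sub>R (\<rho> *\<^sub>R (p + r) - 2 *\<^sub>R q) = (2 * \<alpha> + \<beta> * \<rho>) *\<^sub>R (p + r)"
    by (simp add: algebra_simps)
  then have "(2 * \<alpha> + \<beta> * \<rho>) *\<^sub>R (p + r) \<in> span X"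
    using 1 2 by (metis span_add span_scale)
  then have 4: "p + r \<in> span X"
    using nz by (rule cancel)
  have "2 *\<^sub>R q = \<rho> *\<^sub>R (p + r) - (\<rho> *\<^sub>R (p + r) - 2 *\<^sub>R q)"
    by simp
  then have "2 *\<^sub>R q \<in> span X"
    using 2 4 by (metis span_diff span_scale)
  then have "q \<in> span X"
    by (rule cancel) simp
  have "(p + r) + (p - r) \<in> span X" "(p + r) - (p - r) \<in> span X"
    using span_add[OF 4 3] span_diff[OF 4 3] .
  then have "2 *\<^sub>R p \<in> span X" "2 *\<^sub>R r \<in> span X"
    by (simp_all add: scaleR_2)
  with \<open>q \<in> span X\<close> show ?thesis
    using cancel[of 2 p] cancel[of 2 r] by simp
qed

lemma optimizer_eq:
  "optimizer s m = sqrt (3 * m / 11) *\<^sub>R (site_vec s 1 + site_vec s (- 1)) + sqrt (5 * m / 11) *\<^sub>R site_vec s 0"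
  by (auto simp: vec_eq_iff optimizer_def site_vec_def scaleR_conv_of_real[where 'a = complex])

lemma span_eq_UNIV_if_sites:
  fixes s :: "'n::finite \<Rightarrow> int" and X :: "(complex ^ 'n) set"
  assumes "inj s" "\<And>j. j \<in> range s \<Longrightarrow> site_vec s j \<in> span X \<and> \<i> *s site_vec s j \<in> span X"
  shows "span X = UNIV"
proof -
  have "Basis \<subseteq> span X"
  proof
    fix v :: "complex ^ 'n" assume "v \<in> Basis"
    then obtain i where "v = axis i 1 \<or> v = axis i \<i>"
      by (auto simp: Basis_vec_def Basis_complex_def)
    moreover have "axis i 1 = site_vec s (s i)" "axis i \<i> = \<i> *s site_vec s (s i)"
      using assms(1) by (auto simp: vec_eq_iff axis_def site_vec_def inj_eq)
    ultimately show "v \<in> span X"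
      using assms(2) by auto
  qed
  then show ?thesis
    by (metis span_Basis span_mono span_span top.extremum_uniqueI)
qed

section \<open>The spectrum\<close>

theorem theorem4:
  fixes N :: nat and m :: real and s :: "'n::finite \<Rightarrow> int"
  assumes sites: "bij_betw s UNIV {- int N..int N}"
    and N: "N \<ge> 2"
    and m: "m > 0"
  defines "H \<equiv> hamiltonian N s"
    and "b \<equiv> optimizer s m"
    and "e \<equiv> site_vec s"
    and "far \<equiv> {- int N..int N} - {- 2, - 1, 0, 1, 2}"
  defines "L \<equiv> (\<lambda>u. (14 / 11 * m) *\<^sub>R u + hessian H b u)"
    and "w \<equiv> sqrt (5 / 3) *\<^sub>R (e 1 + e (- 1)) - 2 *\<^sub>R e 0"
  shows
    "(\<forall>j\<in>{- int N..int N}. \<forall>k\<in>{- int N..int N}. hessian_block s H b j k \<noteq> 0 \<longrightarrow>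
        j \<in> {- 2, - 1, 0, 1, 2} \<and> k \<in> {- 2, - 1, 0, 1, 2})
    \<and> eigenvalues L =
        {- 28 / 11 * m, 0} \<union> (\<lambda>j. 14 / 11 * m) ` far \<union>
        {2 / 11 * m, 26 / 11 * m, 12 / 11 * m, 40 / 11 * m, 60 / 11 * m, 8 * m}
    \<and> span (\<Union>\<mu>\<in>eigenvalues L. eigenspace L \<mu>) = UNIV
    \<and> {\<mu> \<in> eigenvalues L. \<mu> < 0} = {- 28 / 11 * m}
    \<and> is_eigenvector L (- 28 / 11 * m) b
    \<and> eigenspace L (- 28 / 11 * m) = span {b}
    \<and> {u. L u = 0} = span {\<i> *s b}
    \<and> dim {u. L u = 0} = 1
    \<and> (\<forall>\<mu>\<in>eigenvalues L - {- 28 / 11 * m, 0}. \<mu> > 0)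
    \<and> (\<forall>j\<in>far. is_eigenvector L (14 / 11 * m) (e j) \<and> is_eigenvector L (14 / 11 * m) (\<i> *s e j))
    \<and> eigenspace L (14 / 11 * m) = span (e ` far \<union> (\<lambda>j. \<i> *s e j) ` far)
    \<and> is_eigenvector L (2 / 11 * m) (e (- 2)) \<and> is_eigenvector L (2 / 11 * m) (e 2)
    \<and> eigenspace L (2 / 11 * m) = span {e (- 2), e 2}
    \<and> is_eigenvector L (26 / 11 * m) (\<i> *s e (- 2)) \<and> is_eigenvector L (26 / 11 * m) (\<i> *s e 2)
    \<and> eigenspace L (26 / 11 * m) = span {\<i> *s e (- 2), \<i> *s e 2}
    \<and> is_eigenvector L (12 / 11 * m) (e 1 - e (- 1))
    \<and> eigenspace L (12 / 11 * m) = span {e 1 - e (- 1)}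
    \<and> is_eigenvector L (40 / 11 * m) (\<i> *s (e 1 - e (- 1)))
    \<and> eigenspace L (40 / 11 * m) = span {\<i> *s (e 1 - e (- 1))}
    \<and> is_eigenvector L (60 / 11 * m) w
    \<and> eigenspace L (60 / 11 * m) = span {w}
    \<and> is_eigenvector L (8 * m) (\<i> *s w)
    \<and> eigenspace L (8 * m) = span {\<i> *s w}"
proof -
  have inj: "inj s" and range: "range s = {- int N..int N}"
    using sites by (auto simp: bij_betw_def)
  have sub: "{- 1, 0, 1} \<subseteq> range s" and two: "- 2 \<in> range s" "2 \<in> range s"
    using N by (auto simp: range)
  have sub': "- 1 \<in> range s" "0 \<in> range s" "1 \<in> range s"
    using sub by auto
  have L: "L = shifted_hessian s m"
    unfolding L_def H_def b_def shifted_hessian_def hessian_hamiltonian[OF sites] ..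
  have lin: "linear L"
    unfolding L by (rule linear_shifted_hessian)
  have r: "sqrt (5 / 3) * sqrt (5 / 3) = (5 / 3 :: real)" by simp
  then have r': "sqrt (5 / 3) * (sqrt (5 / 3) * x) = 5 / 3 * x" for x
    by (simp add: mult.assoc[symmetric])
  \<comment> \<open>Both amplitudes of the optimizer are expressed through one, so that only \<open>sqrt (5 / 3)\<close> remains in the eigenvalue equations.\<close>
  define c where "c = sqrt (3 * m / 11)"
  have "sqrt (5 * m / 11) = c * sqrt (5 / 3)"
    by (simp add: c_def flip: real_sqrt_mult)
  then have b_eq: "b = c *\<^sub>R (e 1 + e (- 1)) + (c * sqrt (5 / 3)) *\<^sub>R e 0"
    by (simp add: b_def e_def optimizer_eq c_def)
  have c: "c > 0" using m by (simp add: c_def)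
  have entry_e: "entry s (e k) j = (if j = k \<and> k \<in> range s then 1 else 0)" for j k
    unfolding e_def by (rule entry_site_vec[OF inj])

  define P where "P = {(- 28 / 11 * m, b), (0, \<i> *s b),
      (2 / 11 * m, e (- 2)), (2 / 11 * m, e 2), (26 / 11 * m, \<i> *s e (- 2)), (26 / 11 * m, \<i> *s e 2),
      (12 / 11 * m, e 1 - e (- 1)), (40 / 11 * m, \<i> *s (e 1 - e (- 1))),
      (60 / 11 * m, w), (8 * m, \<i> *s w)}
      \<union> (\<lambda>j. (14 / 11 * m, e j)) ` far \<union> (\<lambda>j. (14 / 11 * m, \<i> *s e j)) ` far"
  have finP: "finite P"
    by (simp add: P_def far_def)

  note eigI = trimer_eigenI[OF inj sub m, folded L]
  have abs: "\<bar>j\<bar> = 1 \<longleftrightarrow> j = 1 \<or> j = - 1" "\<bar>j\<bar> = 2 \<longleftrightarrow> j = 2 \<or> j = - 2" for j :: int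
    by auto
  note entries = entry_e sub' two trimer_op_def abs
  have "L b = (- 28 / 11 * m) *\<^sub>R b"
    by (rule eigI; simp add: b_eq entries; simp add: algebra_simps r r')
  moreover have "L (\<i> *s b) = (0 / 11 * m) *\<^sub>R (\<i> *s b)"
    by (rule eigI; simp add: b_eq entries; simp add: algebra_simps r r')
  moreover have "L (e k) = (2 / 11 * m) *\<^sub>R e k" "L (\<i> *s e k) = (26 / 11 * m) *\<^sub>R (\<i> *s e k)"
    if "k \<in> {- 2, 2}" for k
    by (rule eigI; use that in \<open>auto simp: entries\<close>)+
  moreover have "L (e 1 - e (- 1)) = (12 / 11 * m) *\<^sub>R (e 1 - e (- 1))"
    by (rule eigI) (simp_all add: entries)
  moreover have "L (\<i> *s (e 1 - e (- 1))) = (40 / 11 * m) *\<^sub>R (\<i> *s (e 1 - e (- 1)))"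
    by (rule eigI) (simp_all add: entries)
  moreover have "L w = (60 / 11 * m) *\<^sub>R w"
    by (rule eigI; simp add: w_def entries; simp add: algebra_simps r r')
  moreover have "L (\<i> *s w) = (88 / 11 * m) *\<^sub>R (\<i> *s w)"
    by (rule eigI; simp add: w_def entries; simp add: algebra_simps r r')
  moreover have "L (e k) = (14 / 11 * m) *\<^sub>R e k" "L (\<i> *s e k) = (14 / 11 * m) *\<^sub>R (\<i> *s e k)"
    if "k \<in> far" for k
    by (rule eigI; use that[unfolded far_def, folded range] in \<open>auto simp: entries\<close>)+
  ultimately have eigP: "L v = \<mu> *\<^sub>R v" if "(\<mu>, v) \<in> P" for \<mu> v
    using that unfolding P_def by auto

  have nz: "v \<noteq> 0" if "entry s v j \<noteq> 0" for v j
    using that by (auto simp: entry_def split: if_splits)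
  have "e k \<noteq> 0" "\<i> *s e k \<noteq> 0" if "k \<in> range s" for k
    using that by (auto intro!: nz[of _ k] simp: entry_e)
  moreover have "b \<noteq> 0" "\<i> *s b \<noteq> 0" "e 1 - e (- 1) \<noteq> 0" "\<i> *s (e 1 - e (- 1)) \<noteq> 0" "w \<noteq> 0" "\<i> *s w \<noteq> 0"
    by (rule nz[of _ 1]; use c in \<open>simp add: entry_e sub' b_eq w_def\<close>)+
  ultimately have nzP: "v \<noteq> 0" if "(\<mu>, v) \<in> P" for \<mu> v
    using that two range unfolding P_def far_def by auto
  have isP: "is_eigenvector L \<mu> v" if "(\<mu>, v) \<in> P" for \<mu> v
    using eigP[OF that] nzP[OF that] by (simp add: is_eigenvector_def)

  \<comment> \<open>Completeness: the unit vectors are recovered block by block.\<close>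
  have spanP: "span (snd ` P) = UNIV"
  proof (rule span_eq_UNIV_if_sites[OF inj], fold e_def)
    fix j assume j: "j \<in> range s"
    have i_b: "\<i> *s b = c *\<^sub>R (\<i> *s e 1 + \<i> *s e (- 1)) + (c * sqrt (5 / 3)) *\<^sub>R (\<i> *s e 0)"
      and i_w: "\<i> *s w = sqrt (5 / 3) *\<^sub>R (\<i> *s e 1 + \<i> *s e (- 1)) - 2 *\<^sub>R (\<i> *s e 0)"
      and i_d: "\<i> *s (e 1 - e (- 1)) = \<i> *s e 1 - \<i> *s e (- 1)"
      by (simp_all add: vec_eq_iff b_eq w_def algebra_simps)
    have pos: "2 * c + c * sqrt (5 / 3) * sqrt (5 / 3) \<noteq> 0"
      using c by (simp add: mult.assoc r)
    have mem: "b \<in> span (snd ` P)" "w \<in> span (snd ` P)" "e 1 - e (- 1) \<in> span (snd ` P)"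
      "\<i> *s b \<in> span (snd ` P)" "\<i> *s w \<in> span (snd ` P)" "\<i> *s (e 1 - e (- 1)) \<in> span (snd ` P)"
      by (rule span_base; simp add: P_def)+
    have "{e 1, e 0, e (- 1)} \<subseteq> span (snd ` P)"
      by (rule span_trimer[OF mem(1)[unfolded b_eq] mem(2)[unfolded w_def] mem(3) pos])
    moreover have "{\<i> *s e 1, \<i> *s e 0, \<i> *s e (- 1)} \<subseteq> span (snd ` P)"
      by (rule span_trimer[OF mem(4)[unfolded i_b] mem(5)[unfolded i_w] mem(6)[unfolded i_d] pos])
    moreover have "e j \<in> span (snd ` P) \<and> \<i> *s e j \<in> span (snd ` P)" if "j \<notin> {- 1, 0, 1}"
      proof (cases "j \<in> far")
      case True
      then show ?thesis
        by (simp add: P_def span_base image_Un image_image)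
    next
      case False
      then have "j \<in> {- 2, 2}"
        using that j by (auto simp: far_def range)
      then show ?thesis
        by (auto simp: P_def intro: span_base)
    qed
    ultimately show "e j \<in> span (snd ` P) \<and> \<i> *s e j \<in> span (snd ` P)"
      by (cases "j \<in> {- 1, 0, 1}") auto
  qed

  have evals: "eigenvalues L = fst ` P"
    by (rule eigenvalues_of_spanning_eigenpairs[OF lin finP isP spanP])
  then have evals': "eigenvalues L =
        {- 28 / 11 * m, 0} \<union> (\<lambda>j. 14 / 11 * m) ` far \<union>
        {2 / 11 * m, 26 / 11 * m, 12 / 11 * m, 40 / 11 * m, 60 / 11 * m, 8 * m}"
    by (auto simp: P_def image_Un image_image)
  have espace: "eigenspace L \<nu> = span {v. (\<nu>, v) \<in> P}" for \<nu>
    by (rule eigenspace_of_spanning_eigenpairs[OF lin finP eigP spanP])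
  have spans: "eigenspace L (- 28 / 11 * m) = span {b}"
    "eigenspace L 0 = span {\<i> *s b}"
    "eigenspace L (14 / 11 * m) = span (e ` far \<union> (\<lambda>j. \<i> *s e j) ` far)"
    "eigenspace L (2 / 11 * m) = span {e (- 2), e 2}"
    "eigenspace L (26 / 11 * m) = span {\<i> *s e (- 2), \<i> *s e 2}"
    "eigenspace L (12 / 11 * m) = span {e 1 - e (- 1)}"
    "eigenspace L (40 / 11 * m) = span {\<i> *s (e 1 - e (- 1))}"
    "eigenspace L (60 / 11 * m) = span {w}"
    "eigenspace L (8 * m) = span {\<i> *s w}"
    unfolding espace using m by (auto simp: P_def intro!: arg_cong[of _ _ span])
  have kernel: "{u. L u = 0} = eigenspace L 0"
    by (simp add: eigenspace_def)
  have "dim {u. L u = 0} = 1"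
    unfolding kernel spans using isP[of 0 "\<i> *s b"] by (simp add: P_def is_eigenvector_def)
  moreover have "span (\<Union>\<mu>\<in>eigenvalues L. eigenspace L \<mu>) = UNIV"
  proof -
    have "snd ` P \<subseteq> (\<Union>\<mu>\<in>eigenvalues L. eigenspace L \<mu>)"
      using eigP unfolding evals by (fastforce simp: eigenspace_def)
    then show ?thesis
      using spanP by (metis span_mono top.extremum_uniqueI)
  qed
  \<comment> \<open>A far column vanishes because the shifted operator is just the shift there; a far row vanishes by the explicit form of the operator.\<close>
  moreover have "hessian_block s H b j k = 0" if jk: "j \<in> far \<or> k \<in> far" for j k
  proof -
    have zero: "coord_vec s j p \<bullet> hess_at s b (coord_vec s k q) = 0" for p q
      using jk
    proof
      assume "k \<in> far"
      then have "(14 / 11 * m, coord_vec s k q) \<in> P"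
        by (auto simp: coord_vec_def P_def e_def)
      from eigP[OF this] have "hess_at s b (coord_vec s k q) = 0"
        by (simp add: L shifted_hessian_def b_def)
      then show ?thesis by simp
    next
      assume "j \<in> far"
      then have j: "j \<in> range s" "j \<noteq> 0" "\<bar>j\<bar> \<noteq> 1" "\<bar>j\<bar> \<noteq> 2"
        by (auto simp: far_def range abs_if)
      have "entry s (hess_at s b v) j = 0" for v
        using entry_shifted_hessian[OF inj j(1) sub m, of v] j
        by (simp add: shifted_hessian_def b_def trimer_op_def complex_eq_iff)
      moreover have "entry s (coord_vec s j p) l = 0" if "l \<noteq> j" for l
        using that by (auto simp: coord_vec_def entry_site_vec[OF inj])
      ultimately show ?thesis
        unfolding inner_entries[OF sites] by (intro sum.neutral) (metis inner_zero_left inner_zero_right)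
    qed
    show ?thesis
      by (simp add: hessian_block_def vec_eq_iff H_def second_partial_hamiltonian[OF sites] zero)
  qed
  then have "\<forall>j\<in>{- int N..int N}. \<forall>k\<in>{- int N..int N}. hessian_block s H b j k \<noteq> 0 \<longrightarrow>
        j \<in> {- 2, - 1, 0, 1, 2} \<and> k \<in> {- 2, - 1, 0, 1, 2}"
    unfolding far_def by blast
  moreover have "{\<mu> \<in> eigenvalues L. \<mu> < 0} = {- 28 / 11 * m}"
    "\<forall>\<mu>\<in>eigenvalues L - {- 28 / 11 * m, 0}. \<mu> > 0"
    unfolding evals' using m by auto
  moreover have "is_eigenvector L (- 28 / 11 * m) b"
    "\<forall>j\<in>far. is_eigenvector L (14 / 11 * m) (e j) \<and> is_eigenvector L (14 / 11 * m) (\<i> *s e j)"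
    "is_eigenvector L (2 / 11 * m) (e (- 2))" "is_eigenvector L (2 / 11 * m) (e 2)"
    "is_eigenvector L (26 / 11 * m) (\<i> *s e (- 2))" "is_eigenvector L (26 / 11 * m) (\<i> *s e 2)"
    "is_eigenvector L (12 / 11 * m) (e 1 - e (- 1))"
    "is_eigenvector L (40 / 11 * m) (\<i> *s (e 1 - e (- 1)))"
    "is_eigenvector L (60 / 11 * m) w" "is_eigenvector L (8 * m) (\<i> *s w)"
    by (auto intro!: isP simp: P_def)
  ultimately show ?thesis
    using evals' spans unfolding kernel by (intro conjI) assumption+
qed

end
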